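(* For every prime $p>3$, $$\sum_{k=0}^{p-1}(-1)^k\binom{k}{0}_2\equiv p\,\frac{3\left(\frac p3\right)-1}{2}\pmod{p^2},\qquad \sum_{k=0}^{p-1}(-1)^k\binom{k}{1}_2\equiv 1-p\,\frac{3\left(\frac p3\right)-1}{2}\pmod{p^2},$$ and $$\sum_{k=0}^{p-1}(-1)^k\binom{k}{2}_2\equiv -2+3p\left(\frac p3\right)\pmod{p^2}.$$
   Context: The trinomial coefficients $\binom{n}{k}_2$ are defined for integers $n\ge 0$ by $(1+x+x^{-1})^n=\sum_{k=-n}^{n}\binom{n}{k}_2x^k$. $\left(\frac{p}{3}\right)$ is the Legendre symbol modulo $3$ (equal to $1$ if $p\equiv1\pmod 3$ and $-1$ if $p\equiv 2\pmod 3$). Congruences of rationals are understood modulo $p^2$ in the ring of rationals with denominator prime to $p$. *)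

theory Defs
  imports
    "HOL-Number_Theory.Number_Theory"
    "HOL-Computational_Algebra.Formal_Laurent_Series"
begin

definition trinomial :: "nat \<Rightarrow> int \<Rightarrow> int" where
  "trinomial n k = fls_nth ((1 + fls_X + fls_X_inv) ^ n) k"

definition p_integral :: "nat \<Rightarrow> rat set" where
  "p_integral p = {x. coprime (snd (quotient_of x)) (int p)}"

text \<open>The modulus is \<open>p ^ m\<close>.\<close>
definition rat_cong :: "nat \<Rightarrow> nat \<Rightarrow> rat \<Rightarrow> rat \<Rightarrow> bool" where
  "rat_cong p m x y \<longleftrightarrow>
     x \<in> p_integral p \<and> y \<in> p_integral p \<and>
     (\<exists>c \<in> p_integral p. x - y = of_nat p ^ m * c)"

end

theory Submission
  imports Defs
begin

text \<open>
  Write \<open>y = 1 + x + 1/x\<close>, so that \<open>1 + y = (1 + x)\<^sup>2 / x\<close> and, for odd \<open>p\<close>,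
  \<open>(x + 2 + 1/x) (\<Sum>k<p. (-y)^k) = 1 + y^p\<close>. Combined with \<open>x dy/dx = x - 1/x\<close> this
  gives the constant coefficient of the sum exactly, as \<open>p (U 0 - U 1)\<close> where \<open>U j\<close> is the
  coefficient of \<open>x^j\<close> in \<open>y^(p-1)\<close>; the next two coefficients then follow from those of
  \<open>y^p\<close>. As \<open>p\<close> divides the coefficients of \<open>y^p\<close> at \<open>0 < j < p\<close>, the \<open>U j\<close> obey
  \<open>U (j-1) + U j + U (j+1) \<equiv> 0 (mod p)\<close> and so are periodic with period 3 modulo \<open>p\<close>.
  Finally, factoring \<open>1 + x + x\<^sup>2 = (1 - \<omega> x) (1 - \<omega>\<^sup>-\<^sup>1 x)\<close> with a primitive cube root of
  unity \<open>\<omega>\<close> shows that the central coefficient of \<open>y^p\<close> is a sum of terms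
  \<open>- (p choose k)\<^sup>2 \<omega>^(2k-p)\<close>, of which only \<open>k = 0\<close> and \<open>k = p\<close> survive modulo \<open>p\<^sup>2\<close>.
\<close>

section \<open>Recurrence, symmetry and support of the coefficients of powers of y\<close>

lemma trinomial_0: "trinomial 0 k = (if k = 0 then 1 else 0)"
  by (simp add: trinomial_def)

lemma trinomial_Suc:
  "trinomial (Suc n) k = trinomial n (k - 1) + trinomial n k + trinomial n (k + 1)"
proof -
  have "(1 + fls_X + fls_X_inv) ^ Suc n
      = (1 + fls_X + fls_X_inv :: int fls) ^ n
        + fls_X * (1 + fls_X + fls_X_inv) ^ n + fls_X_inv * (1 + fls_X + fls_X_inv) ^ n"
    by (simp add: algebra_simps)
  then show ?thesis
    by (simp add: trinomial_def fls_X_times_conv_shift fls_X_inv_times_conv_shift)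
qed

lemma trinomial_minus: "trinomial n (- k) = trinomial n k"
proof (induction n arbitrary: k)
  case 0
  show ?case by (simp add: trinomial_0)
next
  case (Suc n)
  have "trinomial n (- k - 1) = trinomial n (k + 1)" "trinomial n (- k + 1) = trinomial n (k - 1)"
    using Suc[of "k + 1"] Suc[of "k - 1"] by simp_all
  then show ?case by (simp add: trinomial_Suc Suc)
qed

lemma trinomial_eq_0: "k > int n \<Longrightarrow> trinomial n k = 0"
  by (induction n arbitrary: k) (simp_all add: trinomial_0 trinomial_Suc)

lemma trinomial_self: "trinomial n (int n) = 1"
  by (induction n) (simp_all add: trinomial_0 trinomial_Suc trinomial_eq_0)

text \<open>The coefficientwise form of \<open>x d/dx y^(n+1) = (n+1) y^n (x - 1/x)\<close>.\<close>
lemma mult_trinomial_Suc: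
  "k * trinomial (Suc n) k = (int n + 1) * (trinomial n (k - 1) - trinomial n (k + 1))"
proof (induction n arbitrary: k)
  case 0
  show ?case by (auto simp: trinomial_0 trinomial_Suc)
next
  case (Suc n)
  have "k * trinomial (Suc (Suc n)) k
      = (k - 1) * trinomial (Suc n) (k - 1) + k * trinomial (Suc n) k
        + (k + 1) * trinomial (Suc n) (k + 1)
        + (trinomial (Suc n) (k - 1) - trinomial (Suc n) (k + 1))"
    by (simp only: trinomial_Suc[of "Suc n"]) (simp add: algebra_simps)
  also have "\<dots> = (int n + 1) * (trinomial (Suc n) (k - 1) - trinomial (Suc n) (k + 1))
        + (trinomial (Suc n) (k - 1) - trinomial (Suc n) (k + 1))"
    unfolding Suc.IH by (simp add: trinomial_Suc algebra_simps)
  finally show ?case by (simp add: algebra_simps)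
qed

section \<open>Identities for the alternating sums\<close>

lemma alternating_trinomial_sum_0:
  "(\<Sum>k=0..n. (-1) ^ k * trinomial k 0) = (-1) ^ n * (int n + 1) * (trinomial n 0 - trinomial n 1)"
proof (induction n)
  case 0
  show ?case by (simp add: trinomial_0)
next
  case (Suc n)
  \<comment> \<open>The derivative identity at 1 and the recurrence give two values for
    \<open>trinomial (Suc n) 1\<close>; equating them eliminates one of the three coefficients of
    y^n, which is what the induction step needs.\<close>
  have "trinomial (Suc n) 1 = (int n + 1) * (trinomial n 0 - trinomial n 2)"
    using mult_trinomial_Suc[of 1 n] by simp
  moreover have "int n * trinomial (Suc n) 1
      = int n * (trinomial n 0 + trinomial n 1 + trinomial n 2)"
    and "trinomial (Suc n) 0 = trinomial n 0 + 2 * trinomial n 1"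
    and "trinomial (Suc n) 1 = trinomial n 0 + trinomial n 1 + trinomial n 2"
    using trinomial_minus[of n 1] by (simp_all add: trinomial_Suc)
  ultimately have "(int n + 1) * (trinomial n 0 - trinomial n 1) - trinomial (Suc n) 0
      = - (int n + 2) * (trinomial (Suc n) 0 - trinomial (Suc n) 1)"
    by (simp add: algebra_simps)
  then have "(-1) ^ n * ((int n + 1) * (trinomial n 0 - trinomial n 1) - trinomial (Suc n) 0)
      = (-1) ^ n * (- (int n + 2) * (trinomial (Suc n) 0 - trinomial (Suc n) 1))"
    by simp
  then show ?case
    using Suc by (simp add: algebra_simps)
qed

text \<open>Coefficient of x^j in the geometric sum: (1 + y) times the sum of (-y)^k telescopes, and
  1 + y = x + 2 + 1/x.\<close>

lemma alternating_trinomial_sum_three_term: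
  "(\<Sum>k=0..n. (-1) ^ k * trinomial k (j - 1)) + 2 * (\<Sum>k=0..n. (-1) ^ k * trinomial k j)
     + (\<Sum>k=0..n. (-1) ^ k * trinomial k (j + 1))
   = trinomial 0 j + (-1) ^ n * trinomial (Suc n) j"
  by (induction n) (simp_all add: trinomial_Suc algebra_simps)

section \<open>Trinomial coefficients modulo p\<close>

lemma prime_dvd_trinomial:
  assumes "prime p" "0 < j" "j < int p"
  shows "int p dvd trinomial p j"
proof -
  obtain m where m: "p = Suc m"
    using assms(1) by (metis not0_implies_Suc not_prime_0)
  have "int p dvd j * trinomial p j"
    unfolding m mult_trinomial_Suc by (simp add: add.commute)
  moreover have "\<not> int p dvd j"
    using assms(2,3) zdvd_not_zless by blast
  ultimately show ?thesis
    using assms(1) by (simp add: prime_dvd_mult_iff)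
qed

text \<open>Here n is the distance from the top index p - 1. Divisibility of
  \<open>trinomial p j\<close> by p turns the recurrence into a downward recursion modulo p; started
  from 0 at p and 1 at p - 1 it cycles through 1, -1, 0.\<close>

lemma trinomial_pred_prime_cong:
  assumes "prime p" "n < p"
  shows "[trinomial (p - 1) (int p - 1 - int n)
          = (if n mod 3 = 0 then 1 else if n mod 3 = 1 then -1 else 0)] (mod int p)"
  using assms(2)
proof (induction n rule: less_induct)
  case (less n)
  let ?t = "trinomial (p - 1)"
  have p: "Suc (p - 1) = p" "int (p - 1) = int p - 1"
    using less.prems by auto
  have step: "[?t (j - 1) = - ?t j - ?t (j + 1)] (mod int p)" if "0 < j" "j < int p" for j
    using prime_dvd_trinomial[OF assms(1) that] trinomial_Suc[of "p - 1" j] p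
    by (simp add: cong_iff_dvd_diff algebra_simps)
  have top: "?t (int p - 1) = 1" "?t (int p) = 0"
    using trinomial_self[of "p - 1"] trinomial_eq_0[of "p - 1" "int p"] p by simp_all
  consider "n = 0" | "n = 1" | m where "n = Suc (Suc m)"
    by (metis One_nat_def not0_implies_Suc)
  then show ?case
  proof cases
    case 1
    then show ?thesis using top by simp
  next
    case 2
    then show ?thesis using step[of "int p - 1"] top less.prems by simp
  next
    case (3 m)
    have "[?t (int p - 1 - int n) = - ?t (int p - 1 - int (Suc m)) - ?t (int p - 1 - int m)]
            (mod int p)"
      using step[of "int p - 1 - int (Suc m)"] 3 less.prems by (simp add: algebra_simps)
    also have "[- ?t (int p - 1 - int (Suc m)) - ?t (int p - 1 - int m)
        = - (if Suc m mod 3 = 0 then 1 else if Suc m mod 3 = 1 then -1 else 0)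
          - (if m mod 3 = 0 then 1 else if m mod 3 = 1 then -1 else 0)] (mod int p)"
      using less.IH[of "Suc m"] less.IH[of m] 3 less.prems
      by (intro cong_diff cong_minus_minus_iff[THEN iffD2]) auto
    also have "- (if Suc m mod 3 = 0 then 1 else if Suc m mod 3 = 1 then -1 else 0)
          - (if m mod 3 = 0 then 1 else if m mod 3 = 1 then -1 else 0)
        = (if n mod 3 = 0 then 1 else if n mod 3 = 1 then -1 else (0::int))"
    proof -
      consider "m mod 3 = 0" | "m mod 3 = 1" | "m mod 3 = 2" by linarith
      then show ?thesis unfolding 3 by cases (simp_all add: mod_Suc)
    qed
    finally show ?thesis .
  qed
qed

section \<open>The central coefficient via cube roots of unity\<close>

text \<open>Multiplying y^n by x^n gives (1 + x + x^2)^n. The guard is required because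
  \<open>nat\<close> sends negative exponents to 0.\<close>

lemma of_int_trinomial_eq_coeff:
  "of_int (trinomial n k) =
     (if k < - int n then 0 else coeff ([:1, 1, 1:] ^ n :: 'a::comm_ring_1 poly) (nat (int n + k)))"
proof (induction n arbitrary: k)
  case 0
  show ?case by (auto simp: trinomial_0 coeff_1)
next
  case (Suc n)
  have eq: "[:1, 1, 1:] ^ Suc n
      = [:1, 1, 1:] ^ n + pCons 0 ([:1, 1, 1:] ^ n) + pCons 0 (pCons 0 ([:1, 1, 1:] ^ n :: 'a poly))"
    by simp
  \<comment> \<open>The cases record how many of the indices k - 1, k, k + 1 lie below -n: all, two,
    one or none.\<close>
  consider "k < - int n - 1" | "k = - int n - 1" | "k = - int n" | m where "k = int m + 1 - int n"
  proof -
    have "k < - int n - 1 \<or> k = - int n - 1 \<or> k = - int n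
        \<or> k = int (nat (k + int n - 1)) + 1 - int n"
      by linarith
    then show ?thesis using that by blast
  qed
  then show ?case
    unfolding trinomial_Suc of_int_add Suc.IH eq coeff_add
    by cases (simp_all add: coeff_pCons nat_add_distrib split: nat.splits)
qed

lemma of_int_central_trinomial:
  fixes w w' :: "'a :: idom"
  assumes "w + w' = -1" "w * w' = 1"
  shows "of_int (trinomial n 0)
    = (-1) ^ n * (\<Sum>k\<le>n. of_nat (n choose k) ^ 2 * (w ^ k * w' ^ (n - k)))"
proof -
  have factor: "[:1, 1, 1:] = [:1, - w:] * [:1, - w':]"
  proof -
    have "- w - w' = 1"
      using arg_cong[OF assms(1), of uminus] by simp
    with assms(2) show ?thesis by (simp add: mult.commute)
  qed
  have "of_int (trinomial n 0) = coeff ([:1, 1, 1:] ^ n :: 'a poly) n"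
    by (simp add: of_int_trinomial_eq_coeff)
  also have "\<dots> = coeff ([:1, - w:] ^ n * [:1, - w':] ^ n) n"
    unfolding factor power_mult_distrib ..
  also have "\<dots> = (\<Sum>k\<le>n. of_nat (n choose k) * (- w) ^ k *
      (of_nat (n choose (n - k)) * (- w') ^ (n - k)))"
    by (simp add: coeff_mult coeff_linear_poly_power)
  also have "\<dots> = (\<Sum>k\<le>n. (-1) ^ n * (of_nat (n choose k) ^ 2 * (w ^ k * w' ^ (n - k))))"
  proof (rule sum.cong)
    fix k assume "k \<in> {..n}"
    then have "k \<le> n" by simp
    have "(- w) ^ k * (- w') ^ (n - k) = (-1) ^ (k + (n - k)) * (w ^ k * w' ^ (n - k))"
      unfolding power_add by (subst power_minus, subst (2) power_minus) (simp add: algebra_simps)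
    with \<open>k \<le> n\<close>
    show "of_nat (n choose k) * (- w) ^ k * (of_nat (n choose (n - k)) * (- w') ^ (n - k))
       = (-1) ^ n * (of_nat (n choose k) ^ 2 * (w ^ k * w' ^ (n - k)))"
      by (simp add: binomial_symmetric[symmetric] power2_eq_square algebra_simps)
  qed simp
  finally show ?thesis by (simp add: sum_distrib_left)
qed

text \<open>Each of w, w' is the square of the other, so both have cube 1 and the sum has period 3
  in m.\<close>

lemma cube_root_power_sum:
  fixes w w' :: "'a :: idom"
  assumes "w + w' = -1" "w * w' = 1"
  shows "w ^ m + w' ^ m = (if 3 dvd m then 2 else -1)"
proof (induction m rule: less_induct)
  case (less m)
  have square: "a * a = b" if "a + b = -1" "a * b = 1" for a b :: 'a
  proof -
    have "a * a = a * (a + b) - a * b" by (simp add: distrib_left)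
    also have "\<dots> = - 1 - a" using that by simp
    also have "\<dots> = b" using that(1) by (simp add: diff_eq_eq add.commute)
    finally show ?thesis .
  qed
  have squares: "w * w = w'" "w' * w' = w"
    using square[of w w'] square[of w' w] assms by (simp_all add: add.commute mult.commute)
  then have cube: "w ^ 3 = 1" "w' ^ 3 = 1"
    using assms(2) by (simp_all add: power3_eq_cube mult.commute)
  consider "m = 0" | "m = 1" | "m = 2" | l where "m = l + 3"
    by (metis One_nat_def add_Suc_right add_0_right not0_implies_Suc numeral_2_eq_2 numeral_3_eq_3)
  then show ?case
  proof cases
    case 3
    then show ?thesis
      using assms(1) squares by (simp add: power2_eq_square add.commute)
  next
    case (4 l)
    then show ?thesis using less.IH[of l] cube by (simp add: power_add)
  qed (use assms in auto)
qed

text \<open>Adding the formula to its copy with w and w' exchanged makes every summand an integer;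
  hence the factor 2.\<close>

lemma double_central_trinomial:
  "2 * trinomial n 0 = (-1) ^ n * (\<Sum>k\<le>n. int (n choose k) ^ 2 * (if 3 dvd n + k then 2 else -1))"
proof -
  define w where "w = Complex (- 1 / 2) (sqrt 3 / 2)"
  define w' where "w' = cnj w"
  have w: "w + w' = -1" "w * w' = 1"
    by (simp_all add: w_def w'_def complex_eq_iff power2_eq_square[symmetric] field_simps)
  then have w_swap: "w' + w = -1" "w' * w = 1"
    by (simp_all add: algebra_simps)
  have squares: "w ^ 2 = w'" "w' ^ 2 = w"
    by (simp_all add: w_def w'_def complex_eq_iff power2_eq_square field_simps)
  have term_eq: "w ^ k * w' ^ (n - k) + w' ^ k * w ^ (n - k) = (if 3 dvd n + k then 2 else -1)"
    if "k \<le> n" for k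
  proof -
    \<comment> \<open>Since w' = w^2, only one exponent remains, 2n - k, which is congruent to -(n +
      k) modulo 3.\<close>
    have "w ^ k * w' ^ (n - k) + w' ^ k * w ^ (n - k)
        = w ^ (k + 2 * (n - k)) + w' ^ (k + 2 * (n - k))"
      by (simp add: power_add power_mult squares)
    moreover have "3 dvd k + 2 * (n - k) \<longleftrightarrow> 3 dvd n + k"
      using that by presburger
    ultimately show ?thesis
      using cube_root_power_sum[OF w] by simp
  qed
  have "complex_of_int (2 * trinomial n 0) = of_int (trinomial n 0) + of_int (trinomial n 0)"
    by simp
  also have "\<dots> = (-1) ^ n * (\<Sum>k\<le>n. of_nat (n choose k) ^ 2 *
      (w ^ k * w' ^ (n - k) + w' ^ k * w ^ (n - k)))"
    by (subst of_int_central_trinomial[OF w], subst of_int_central_trinomial[OF w_swap])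
       (simp add: distrib_left sum.distrib)
  also have "\<dots> = (-1) ^ n * (\<Sum>k\<le>n. of_nat (n choose k) ^ 2 * (if 3 dvd n + k then 2 else -1))"
    using term_eq by (intro arg_cong2[where f = "(*)"] sum.cong refl) auto
  also have "\<dots> = of_int ((-1) ^ n *
      (\<Sum>k\<le>n. int (n choose k) ^ 2 * (if 3 dvd n + k then 2 else -1)))"
    by (simp add: if_distrib[of of_int] cong: if_cong)
  finally show ?thesis
    by (simp only: of_int_eq_iff)
qed

text \<open>For 0 < k < p the squared binomial is divisible by p^2. The two end terms have weight -1
  because 3 divides neither p nor 2p, and the sign (-1)^p turns their sum into 2.\<close>

lemma central_trinomial_prime_cong:
  assumes "prime p" "p > 3"
  shows "[trinomial p 0 = 1] (mod int p ^ 2)"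
proof -
  define f :: "nat \<Rightarrow> int"
    where "f k = int (p choose k) ^ 2 * (if 3 dvd p + k then 2 else -1)" for k
  have "odd p" "\<not> 3 dvd p"
    using assms primes_dvd_imp_eq[of 3 p] prime_odd_nat[of p] by auto
  then have "\<not> 3 dvd p + p" by presburger
  have "{..p} = insert 0 (insert p {1..<p})"
    using assms(2) by auto
  then have "(\<Sum>k\<le>p. f k) = f 0 + (f p + (\<Sum>k=1..<p. f k))"
    using assms(2) by simp
  also have "f 0 = -1"
    using \<open>\<not> 3 dvd p\<close> by (simp add: f_def)
  also have "f p = -1"
    using \<open>\<not> 3 dvd p + p\<close> by (simp add: f_def)
  finally have "2 * trinomial p 0 - 2 = - (\<Sum>k=1..<p. f k)"
    using double_central_trinomial[of p] \<open>odd p\<close> by (simp add: f_def[symmetric])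
  moreover have "int p ^ 2 dvd (\<Sum>k=1..<p. f k)"
    unfolding f_def using assms(1)
    by (intro dvd_sum dvd_mult2 dvd_power_same) (simp add: dvd_choose_prime)
  ultimately have "int p ^ 2 dvd 2 * (trinomial p 0 - 1)"
    by (simp add: right_diff_distrib)
  moreover have "coprime (int p ^ 2) 2"
    using \<open>odd p\<close> by simp
  ultimately show ?thesis
    by (metis cong_iff_dvd_diff coprime_dvd_mult_right_iff)
qed

section \<open>The Legendre symbol modulo 3 and passage to rational congruences\<close>

lemma Legendre_3:
  assumes "\<not> 3 dvd a"
  shows "Legendre a 3 = (if a mod 3 = 1 then 1 else -1)"
proof -
  have "QuadRes 3 a \<longleftrightarrow> a mod 3 = 1"
  proof
    assume "QuadRes 3 a"
    then obtain y where "y\<^sup>2 mod 3 = a mod 3"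
      by (auto simp: QuadRes_def cong_def)
    moreover have "y\<^sup>2 mod 3 = (y mod 3)\<^sup>2 mod 3"
      by (simp add: power_mod)
    ultimately have a_mod: "a mod 3 = (y mod 3)\<^sup>2 mod 3"
      by (rule trans[OF sym])
    consider "y mod 3 = 0" | "y mod 3 = 1" | "y mod 3 = 2"
      using pos_mod_bound[of 3 y] pos_mod_sign[of 3 y] by linarith
    then show "a mod 3 = 1"
      using assms unfolding dvd_eq_mod_eq_0 a_mod by cases simp_all
  next
    assume "a mod 3 = 1"
    then show "QuadRes 3 a"
      unfolding QuadRes_def cong_def by (intro exI[of _ 1]) simp
  qed
  then show ?thesis
    using assms by (simp add: Legendre_def cong_0_iff)
qed

lemma rat_cong_of_int:
  assumes "[a = b] (mod int p ^ m)"
  shows "rat_cong p m (of_int a) (of_int b)"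
proof -
  have int_mem: "of_int c \<in> p_integral p" for c
    by (simp add: p_integral_def)
  obtain c where "a - b = int p ^ m * c"
    using assms by (auto simp: cong_iff_dvd_diff)
  then have "(of_int a - of_int b :: rat) = of_nat p ^ m * of_int c"
    by (metis of_int_diff of_int_mult of_int_of_nat_eq of_int_power)
  then show ?thesis
    using int_mem by (auto simp: rat_cong_def)
qed

section \<open>Assembly of the three congruences\<close>

theorem theorem1p3:
  fixes p :: nat
  assumes "prime p" and "p > 3"
  shows "rat_cong p 2
           (of_int (\<Sum>k = 0..p - 1. (-1) ^ k * trinomial k 0))
           (of_nat p * ((3 * of_int (Legendre (int p) 3) - 1) / 2))
       \<and> rat_cong p 2
           (of_int (\<Sum>k = 0..p - 1. (-1) ^ k * trinomial k 1))
           (1 - of_nat p * ((3 * of_int (Legendre (int p) 3) - 1) / 2))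
       \<and> rat_cong p 2
           (of_int (\<Sum>k = 0..p - 1. (-1) ^ k * trinomial k 2))
           (- 2 + 3 * of_nat p * of_int (Legendre (int p) 3))"
proof -
  define s where "s j = (\<Sum>k = 0..p - 1. (-1) ^ k * trinomial k j)" for j
  define U where "U = trinomial (p - 1)"
  define L where "L = Legendre (int p) 3"
  \<comment> \<open>The integer value of (3L - 1)/2 for L = 1 and L = -1.\<close>
  define e :: int where "e = (if p mod 3 = 1 then 1 else -2)"
  have odd: "odd p" and not3: "\<not> 3 dvd p"
    using assms primes_dvd_imp_eq[of 3 p] prime_odd_nat[of p] by auto
  have p: "Suc (p - 1) = p" "int (p - 1) = int p - 1" "(-1) ^ (p - 1) = (1::int)"
    using assms odd by auto
  have "\<not> 3 dvd int p"
    using not3 by (metis of_nat_dvd_iff of_nat_numeral)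
  moreover have "int p mod 3 = int (p mod 3)"
    by (simp add: zmod_int)
  ultimately have L: "L = (if p mod 3 = 1 then 1 else -1)"
    using Legendre_3[of "int p"] by (simp add: L_def)
  \<comment> \<open>The indices 0, 1, 2 of \<open>U\<close> lie at distances m + 2, m + 1, m from p
    - 1.\<close>
  obtain m where m: "p = m + 3"
    using assms(2) by (metis add.commute le_Suc_ex less_imp_le)
  have m_mod: "p mod 3 = m mod 3" "m mod 3 = 1 \<or> m mod 3 = 2"
    using not3 mod_less_divisor[of 3 m] unfolding m dvd_eq_mod_eq_0 by simp_all linarith
  have m_less: "Suc (Suc m) < p" "Suc m < p" "m < p"
    and m_arg: "int p - 1 - int (Suc (Suc m)) = 0" "int p - 1 - int (Suc m) = 1" "int p - 1 - int m = 2"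
    by (simp_all add: m)
  note U_cong = m_less[THEN trinomial_pred_prime_cong[OF assms(1)], unfolded m_arg, folded U_def]
  have U: "[U 0 = (if p mod 3 = 1 then 1 else -1)] (mod int p)"
    "[U 1 = (if p mod 3 = 1 then 0 else 1)] (mod int p)"
    "[U 2 = (if p mod 3 = 1 then -1 else 0)] (mod int p)"
    using m_mod(2) by (rule disjE; use U_cong in \<open>simp add: mod_Suc m_mod(1)\<close>)+
  \<comment> \<open>A factor p in the exact formulas for \<open>s 0\<close> and
    \<open>trinomial p 1\<close> means that \<open>U\<close> is needed only modulo p.\<close>
  have lift: "[int p * a = int p * b] (mod int p ^ 2)" if "[a = b] (mod int p)" for a b
    using that by (simp add: cong_iff_dvd_diff power2_eq_square flip: right_diff_distrib)
  have "s 0 = int p * (U 0 - U 1)"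
    using alternating_trinomial_sum_0[of "p - 1"] p by (simp add: s_def U_def)
  moreover have "[U 0 - U 1 = e] (mod int p)"
    using cong_diff[OF U(1,2)] by (auto simp: e_def split: if_splits)
  ultimately have s0: "[s 0 = int p * e] (mod int p ^ 2)"
    using lift by simp
  have "trinomial p 1 = int p * (U 0 - U 2)"
    using mult_trinomial_Suc[of 1 "p - 1"] p by (simp add: U_def)
  \<comment> \<open>Written with \<open>e\<close> rather than as e + 1, so that \<open>e\<close>
    cancels in the formula for \<open>s 2\<close>.\<close>
  moreover have "[U 0 - U 2 = 3 * L - e] (mod int p)"
    using cong_diff[OF U(1,3)] by (auto simp: e_def L split: if_splits)
  ultimately have t1: "[trinomial p 1 = int p * (3 * L - e)] (mod int p ^ 2)"
    using lift by simp
  note t0 = central_trinomial_prime_cong[OF assms]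
  \<comment> \<open>Symmetry merges the outer terms of the three-term relation at j = 0, leaving
    only \<open>s 0 + s 1\<close>.\<close>
  have "s (-1) = s 1"
    by (simp add: s_def trinomial_minus)
  then have s01: "2 * (s 0 + s 1) = 1 + trinomial p 0"
    using alternating_trinomial_sum_three_term[of 0 "p - 1"] p
    by (simp add: s_def trinomial_0)
  then have "int p ^ 2 dvd 2 * (s 0 + s 1 - 1)"
    using t0 by (simp add: cong_iff_dvd_diff algebra_simps)
  moreover have "coprime (int p ^ 2) 2"
    using odd by simp
  ultimately have "[s 0 + s 1 = 1] (mod int p ^ 2)"
    by (metis cong_iff_dvd_diff coprime_dvd_mult_right_iff)
  from cong_diff[OF this s0] have s1: "[s 1 = 1 - int p * e] (mod int p ^ 2)"
    by simp
  have "s 2 = trinomial p 1 - 2 * s 1 - s 0"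
    using alternating_trinomial_sum_three_term[of 1 "p - 1"] p
    by (simp add: s_def trinomial_0)
  also have "[\<dots> = int p * (3 * L - e) - 2 * (1 - int p * e) - int p * e] (mod int p ^ 2)"
    by (intro cong_diff cong_mult t1 s1 s0 cong_refl)
  also have "int p * (3 * L - e) - 2 * (1 - int p * e) - int p * e = - 2 + 3 * int p * L"
    by (simp add: algebra_simps)
  finally have s2: "[s 2 = - 2 + 3 * int p * L] (mod int p ^ 2)" .
  have e_rat: "(3 * of_int L - 1) / 2 = (of_int e :: rat)"
    by (simp add: e_def L)
  show ?thesis
    using rat_cong_of_int[OF s0] rat_cong_of_int[OF s1] rat_cong_of_int[OF s2]
    unfolding L_def[symmetric] e_rat by (simp add: s_def)
qed

end
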